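(* Let $X$ be a real Banach space with a normalized subsymmetric basis $(\varphi_i)_{i\ge1}$ whose subsymmetric constant is $1$. The following statements are equivalent: (i) There is a constant $\delta>0$, independent of $n$, such that $\varrho_n/(n\sqrt n)\ge\delta$ for every $n\in\mathbb{N}_{\mathcal H}$. (ii) $X$ is isomorphic to $l_1$. (iii) There is a constant $\varepsilon>0$, independent of $n$, such that $\varrho^{(n)}/(n\cdot2^n)\ge\varepsilon$ for every $n=1,2,\ldots$.
   Context: A (Schauder) basis $(\varphi_i)$ of a Banach space $X$ is normalized if $\|\varphi_i\|=1$ for all $i$. It is unconditional if $(\varphi_{\pi(i)})$ is a basis of $X$ for every permutation $\pi$ of $\mathbb{N}$. Two bases $(\varphi_i)$, $(\psi_i)$ are equivalent if $\sum\alpha_i\varphi_i$ converges if and only if $\sum\alpha_i\psi_i$ converges. A basis is subsymmetric if it is unconditional and $(\varphi_{i_n})$ is equivalent to $(\varphi_i)$ for every increasing sequence of positive integers $(i_n)$. Its subsymmetric constant is the smallest $K$ such that $\|\sum_{n}\vartheta_n\alpha_n\varphi_{i_n}\|\le K\|\sum_{i}\alpha_i\varphi_i\|$ for all scalars $(\alpha_i)$ for which $\sum_i\alpha_i\varphi_i$ converges, all signs $\vartheta_n\in\{-1,1\}$ and all increasing sequences of positive integers $(i_n)$. A Hadamard matrix of order $n$ is an $n\times n$ matrix with entries $\pm1$ whose columns (equivalently, rows) are pairwise orthogonal. $\mathbb{N}_{\mathcal H}$ is the set of positive integers $n$ for which a Hadamard matrix of order $n$ exists, and $\mathcal H_n^{all}$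 is the set of all Hadamard matrices of order $n$. For $\mathcal H_n=[h^n_{ki}]\in\mathcal H_n^{all}$ ($k$ the row index, $i$ the column index) put $$\varrho_{\mathcal H_n}=\max_{1\le m\le n}\left\|\sum_{i=1}^n\left(\sum_{k=1}^m h^n_{ki}\right)\varphi_i\right\|,\qquad \varrho_n=\max_{\mathcal H_n\in\mathcal H_n^{all}}\varrho_{\mathcal H_n}.$$ The Sylvester matrices $\mathcal S^{(n)}=[s^{(n)}_{ki}]$ (of order $2^n$; $k$ the row index, $i$ the column index) are defined by $\mathcal S^{(1)}=\begin{bmatrix}1&1\\1&-1\end{bmatrix}$ and $\mathcal S^{(n)}=\begin{bmatrix}\mathcal S^{(n-1)}&\mathcal S^{(n-1)}\\ \mathcal S^{(n-1)}&-\mathcal S^{(n-1)}\end{bmatrix}$ for $n\ge2$, and $$\varrho^{(n)}=\max_{1\le m\le 2^n}\left\|\sum_{i=1}^{2^n}\left(\sum_{k=1}^m s_{ki}^{(n)}\right)\varphi_i\right\|.$$ *)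

theory Defs
  imports Complex_Main "Jordan_Normal_Form.Matrix"
begin

text \<open>Sequences are indexed from 0: \<open>\<phi> i\<close> is the basis vector with (one-based) number \<open>i + 1\<close>,
  and rows and columns of matrices are likewise numbered from 0.\<close>

definition schauder_basis :: "(nat \<Rightarrow> 'a::real_normed_vector) \<Rightarrow> bool" where
  "schauder_basis \<phi> \<longleftrightarrow> (\<forall>x. \<exists>!\<alpha>::nat \<Rightarrow> real. (\<lambda>i. \<alpha> i *\<^sub>R \<phi> i) sums x)"

definition normalized :: "(nat \<Rightarrow> 'a::real_normed_vector) \<Rightarrow> bool" where
  "normalized \<phi> \<longleftrightarrow> (\<forall>i. norm (\<phi> i) = 1)"

definition unconditional_basis :: "(nat \<Rightarrow> 'a::real_normed_vector) \<Rightarrow> bool" where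
  "unconditional_basis \<phi> \<longleftrightarrow> (\<forall>\<pi>::nat \<Rightarrow> nat. bij \<pi> \<longrightarrow> schauder_basis (\<lambda>i. \<phi> (\<pi> i)))"

definition equivalent_bases ::
  "(nat \<Rightarrow> 'a::real_normed_vector) \<Rightarrow> (nat \<Rightarrow> 'b::real_normed_vector) \<Rightarrow> bool" where
  "equivalent_bases \<phi> \<psi> \<longleftrightarrow>
    (\<forall>\<alpha>::nat \<Rightarrow> real. summable (\<lambda>i. \<alpha> i *\<^sub>R \<phi> i) \<longleftrightarrow> summable (\<lambda>i. \<alpha> i *\<^sub>R \<psi> i))"

definition subsymmetric_basis :: "(nat \<Rightarrow> 'a::real_normed_vector) \<Rightarrow> bool" where
  "subsymmetric_basis \<phi> \<longleftrightarrow> unconditional_basis \<phi> \<and>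
    (\<forall>s::nat \<Rightarrow> nat. strict_mono s \<longrightarrow> equivalent_bases (\<lambda>n. \<phi> (s n)) \<phi>)"

text \<open>For a subsymmetric basis of a Banach space the series on the left-hand side always
  converges, so \<^const>\<open>suminf\<close> is the actual sum there.\<close>

definition subsymmetric_bound :: "(nat \<Rightarrow> 'a::real_normed_vector) \<Rightarrow> real \<Rightarrow> bool" where
  "subsymmetric_bound \<phi> K \<longleftrightarrow>
    (\<forall>(\<alpha>::nat \<Rightarrow> real) (\<theta>::nat \<Rightarrow> real) (s::nat \<Rightarrow> nat).
      summable (\<lambda>i. \<alpha> i *\<^sub>R \<phi> i) \<longrightarrow> (\<forall>n. \<theta> n \<in> {-1, 1}) \<longrightarrow> strict_mono s \<longrightarrow>
      norm (\<Sum>n. (\<theta> n * \<alpha> n) *\<^sub>R \<phi> (s n)) \<le> K * norm (\<Sum>i. \<alpha> i *\<^sub>R \<phi> i))"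

text \<open>``The subsymmetric constant of \<open>\<phi>\<close> is \<open>K\<close>'', stated relationally so that no default value
  arises when there is no smallest bound.\<close>

definition is_subsymmetric_constant :: "(nat \<Rightarrow> 'a::real_normed_vector) \<Rightarrow> real \<Rightarrow> bool" where
  "is_subsymmetric_constant \<phi> K \<longleftrightarrow>
    subsymmetric_bound \<phi> K \<and> (\<forall>K'. subsymmetric_bound \<phi> K' \<longrightarrow> K \<le> K')"

definition hadamard_matrix :: "nat \<Rightarrow> real mat \<Rightarrow> bool" where
  "hadamard_matrix n H \<longleftrightarrow> H \<in> carrier_mat n n \<and>
    (\<forall>k<n. \<forall>i<n. H $$ (k, i) \<in> {-1, 1}) \<and>
    (\<forall>i<n. \<forall>j<n. i \<noteq> j \<longrightarrow> scalar_prod (col H i) (col H j) = 0)"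

definition hadamard_orders :: "nat set" where
  "hadamard_orders = {n. n \<ge> 1 \<and> (\<exists>H. hadamard_matrix n H)}"

definition rho_matrix :: "(nat \<Rightarrow> 'a::real_normed_vector) \<Rightarrow> nat \<Rightarrow> real mat \<Rightarrow> real" where
  "rho_matrix \<phi> n H =
    Max ((\<lambda>m. norm (\<Sum>i<n. (\<Sum>k<m. H $$ (k, i)) *\<^sub>R \<phi> i)) ` {1..n})"

text \<open>Matrices of a fixed dimension are determined by their entries, so there are only
  finitely many Hadamard matrices of order \<open>n\<close> and the maximum below is a genuine one
  for \<open>n \<in> hadamard_orders\<close>.\<close>

definition rho :: "(nat \<Rightarrow> 'a::real_normed_vector) \<Rightarrow> nat \<Rightarrow> real" where
  "rho \<phi> n = Max (rho_matrix \<phi> n ` {H. hadamard_matrix n H})"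

text \<open>The value at 0 is only a convention; the recursion starts at 1.\<close>

fun sylvester :: "nat \<Rightarrow> real mat" where
  "sylvester 0 = 1\<^sub>m 1"
| "sylvester (Suc 0) = mat_of_rows_list 2 [[1, 1], [1, -1]]"
| "sylvester (Suc (Suc n)) =
    four_block_mat (sylvester (Suc n)) (sylvester (Suc n))
                   (sylvester (Suc n)) (- sylvester (Suc n))"

definition rho_sylvester :: "(nat \<Rightarrow> 'a::real_normed_vector) \<Rightarrow> nat \<Rightarrow> real" where
  "rho_sylvester \<phi> n = rho_matrix \<phi> (2 ^ n) (sylvester n)"

typedef l1 = "{a::nat \<Rightarrow> real. summable (\<lambda>i. \<bar>a i\<bar>)}"
  morphisms l1_nth Abs_l1
  by (rule exI[of _ "\<lambda>_. 0"]) simp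

setup_lifting type_definition_l1

instantiation l1 :: real_normed_vector
begin

lift_definition zero_l1 :: l1 is "\<lambda>_. 0" by simp

lift_definition plus_l1 :: "l1 \<Rightarrow> l1 \<Rightarrow> l1" is "\<lambda>a b i. a i + b i"
proof -
  fix a b :: "nat \<Rightarrow> real"
  assume "summable (\<lambda>i. \<bar>a i\<bar>)" "summable (\<lambda>i. \<bar>b i\<bar>)"
  from summable_add[OF this] show "summable (\<lambda>i. \<bar>a i + b i\<bar>)"
    by (rule summable_comparison_test') auto
qed

lift_definition uminus_l1 :: "l1 \<Rightarrow> l1" is "\<lambda>a i. - a i" by simp

lift_definition minus_l1 :: "l1 \<Rightarrow> l1 \<Rightarrow> l1" is "\<lambda>a b i. a i - b i"
proof -
  fix a b :: "nat \<Rightarrow> real"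
  assume "summable (\<lambda>i. \<bar>a i\<bar>)" "summable (\<lambda>i. \<bar>b i\<bar>)"
  from summable_add[OF this] show "summable (\<lambda>i. \<bar>a i - b i\<bar>)"
    by (rule summable_comparison_test') auto
qed

lift_definition scaleR_l1 :: "real \<Rightarrow> l1 \<Rightarrow> l1" is "\<lambda>r a i. r * a i"
  by (auto simp: abs_mult intro: summable_mult)

lift_definition norm_l1 :: "l1 \<Rightarrow> real" is "\<lambda>a. \<Sum>i. \<bar>a i\<bar>" .

definition dist_l1 :: "l1 \<Rightarrow> l1 \<Rightarrow> real" where
  "dist_l1 a b = norm (a - b)"

definition sgn_l1 :: "l1 \<Rightarrow> l1" where
  "sgn_l1 a = inverse (norm a) *\<^sub>R a"

definition uniformity_l1 :: "(l1 \<times> l1) filter" where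
  "uniformity_l1 = (INF e\<in>{0<..}. principal {(x, y). dist x y < e})"

definition open_l1 :: "l1 set \<Rightarrow> bool" where
  "open_l1 U = (\<forall>x\<in>U. eventually (\<lambda>(x', y). x' = x \<longrightarrow> y \<in> U) uniformity)"

instance
proof
  fix a b c :: l1 and r s :: real
  show "a + b + c = a + (b + c)" "a + b = b + a" "0 + a = a" "- a + a = 0" "a - b = a + - b"
    by (transfer; auto)+
  show "r *\<^sub>R (a + b) = r *\<^sub>R a + r *\<^sub>R b" "(r + s) *\<^sub>R a = r *\<^sub>R a + s *\<^sub>R a"
    "r *\<^sub>R s *\<^sub>R a = (r * s) *\<^sub>R a" "1 *\<^sub>R a = a"
    by (transfer; auto simp: algebra_simps)+
  show "dist a b = norm (a - b)" by (fact dist_l1_def)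
  show "sgn a = inverse (norm a) *\<^sub>R a" by (fact sgn_l1_def)
  show "(uniformity :: (l1 \<times> l1) filter) = (INF e\<in>{0<..}. principal {(x, y). dist x y < e})"
    by (fact uniformity_l1_def)
  show "norm (r *\<^sub>R a) = \<bar>r\<bar> * norm a"
    by transfer (simp add: abs_mult suminf_mult)
  show "(norm a = 0) = (a = 0)"
    by transfer (auto simp: suminf_eq_zero_iff)
  show "norm (a + b) \<le> norm a + norm b"
  proof transfer
    fix a b :: "nat \<Rightarrow> real"
    assume a: "summable (\<lambda>i. \<bar>a i\<bar>)" and b: "summable (\<lambda>i. \<bar>b i\<bar>)"
    have "(\<Sum>i. \<bar>a i + b i\<bar>) \<le> (\<Sum>i. \<bar>a i\<bar> + \<bar>b i\<bar>)"
      by (intro suminf_le summable_add a b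
            summable_comparison_test'[OF summable_add[OF a b]]) auto
    then show "(\<Sum>i. \<bar>a i + b i\<bar>) \<le> (\<Sum>i. \<bar>a i\<bar>) + (\<Sum>i. \<bar>b i\<bar>)"
      by (simp add: suminf_add[OF a b])
  qed
next
  fix U :: "l1 set"
  show "open U = (\<forall>x\<in>U. eventually (\<lambda>(x', y). x' = x \<longrightarrow> y \<in> U) uniformity)"
    by (fact open_l1_def)
qed

end

definition isomorphic_spaces ::
  "'a::real_normed_vector itself \<Rightarrow> 'b::real_normed_vector itself \<Rightarrow> bool" where
  "isomorphic_spaces X Y \<longleftrightarrow>
    (\<exists>T::'a \<Rightarrow> 'b. bounded_linear T \<and> bij T \<and> bounded_linear (inv_into UNIV T))"

end

theory Submission
  imports Defs "Jordan_Normal_Form.Determinant"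
begin

text \<open>
  All three conditions are shown to be equivalent to linear growth of the fundamental function
  \<open>\<Lambda> n = norm (\<Sum>i<n. \<phi> i)\<close>.

  Since the subsymmetric constant is one, the norm does not increase when signs are changed, when
  coordinates are spread out, or when the moduli of the coordinates decrease (\<open>norm_mono_abs\<close>).
  Averaging translates shows that linear growth of \<open>\<Lambda>\<close> already gives a lower \<open>l1\<close> estimate for all
  coefficients (\<open>norm_ge_sum_abs\<close>), and then the space is isomorphic to \<open>l1\<close> through the basis.
  Conversely, suppose that the space is isomorphic to \<open>l1\<close>. Either some coordinate of the images of the
  basis vectors does not tend to zero, or a gliding hump argument finds almost disjoint images; both
  alternatives force linear growth (\<open>linear_growth_if_isomorphic_l1\<close>).

  For Hadamard matrices, orthogonality fixes the Euclidean norm of the vector of column sums. If the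
  norm of such a vector has the order \<open>n * sqrt n\<close>, truncation shows that \<open>\<Lambda> n\<close> has the order \<open>n\<close>
  (\<open>norm_le_truncation\<close>). The Sylvester matrices supply infinitely many orders to which this applies.
  In the other direction, changing the signs of the rows suitably gives column sums of
  average modulus \<open>sqrt n\<close> by Khintchine's inequality (\<open>exists_signs_sum_abs_ge\<close>).

  For Sylvester matrices the column sums are Walsh-Dirichlet kernels. The largest of their
  Lebesgue constants grows logarithmically in the order of the matrix, which gives the factor \<open>n\<close> in one direction
  (\<open>exists_large_walsh_lebesgue\<close>). The dyadic structure of the kernels bounds their norm by a sum of
  about \<open>n\<close> values of \<open>\<Lambda> m / m\<close> along powers of two, and as these values are nonincreasing, none of them can
  be small (\<open>linear_growth_if_rho_sylvester_ge\<close>).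
\<close>

section \<open>Norm estimates for sequences with subsymmetric constant one\<close>

lemma sum_lessThan_add:
  fixes f :: "nat \<Rightarrow> 'a::comm_monoid_add"
  shows "(\<Sum>i<m + n. f i) = (\<Sum>i<m. f i) + (\<Sum>k<n. f (k + m))"
  by (induction n) (simp_all add: ac_simps)

locale one_subsymmetric_sequence =
  fixes \<phi> :: "nat \<Rightarrow> 'a::banach"
  assumes norm_one: "norm (\<phi> i) = 1"
    and bound: "subsymmetric_bound \<phi> 1"
begin

text \<open>The bound on the subsymmetric constant concerns infinite series; applied to finitely supported
  coefficients it becomes an inequality between finite sums.\<close>

lemma norm_spread_le:
  assumes "strict_mono s" and "\<And>k. \<theta> k \<in> {-1, 1}"
  shows "norm (\<Sum>k<n. (\<theta> k * a k) *\<^sub>R \<phi> (s k)) \<le> norm (\<Sum>k<n. a k *\<^sub>R \<phi> k)"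
proof -
  let ?a = "\<lambda>k. if k < n then a k else 0"
  have "summable (\<lambda>i. ?a i *\<^sub>R \<phi> i)"
    by (rule summable_finite[of "{..<n}"]) auto
  then have "norm (\<Sum>k. (\<theta> k * ?a k) *\<^sub>R \<phi> (s k)) \<le> 1 * norm (\<Sum>k. ?a k *\<^sub>R \<phi> k)"
    using bound[unfolded subsymmetric_bound_def, rule_format, of ?a \<theta> s] assms by blast
  moreover have "(\<Sum>k. (\<theta> k * ?a k) *\<^sub>R \<phi> (s k)) = (\<Sum>k<n. (\<theta> k * ?a k) *\<^sub>R \<phi> (s k))"
    by (rule suminf_finite) auto
  moreover have "(\<Sum>k. ?a k *\<^sub>R \<phi> k) = (\<Sum>k<n. ?a k *\<^sub>R \<phi> k)"
    by (rule suminf_finite) auto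
  ultimately show ?thesis by simp
qed

lemma norm_sum_le_sum_abs: "norm (\<Sum>i\<in>A. a i *\<^sub>R \<phi> i) \<le> (\<Sum>i\<in>A. \<bar>a i\<bar>)"
  by (rule order.trans[OF norm_sum]) (simp add: norm_one)

text \<open>If \<open>t = s * c j\<close> with \<open>\<bar>s\<bar> \<le> 1\<close>, the vector with \<open>j\<close>-th coordinate \<open>t\<close> is a convex combination of
  the given vector and of its reflection in that coordinate, and the reflection has no larger norm.\<close>

lemma norm_shrink_coordinate:
  assumes "\<bar>t\<bar> \<le> \<bar>c j\<bar>"
  shows "norm (\<Sum>i<n. (c(j := t)) i *\<^sub>R \<phi> i) \<le> norm (\<Sum>i<n. c i *\<^sub>R \<phi> i)"
proof (cases "c j = 0")
  case True
  with assms have "c(j := t) = c" by auto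
  then show ?thesis by simp
next
  case False
  define s where "s = t / c j"
  have s: "\<bar>s\<bar> \<le> 1" and t: "t = s * c j"
    using assms False by (auto simp: s_def divide_le_eq)
  let ?x = "\<Sum>i<n. c i *\<^sub>R \<phi> i" and ?y = "\<Sum>i<n. (c(j := - c j)) i *\<^sub>R \<phi> i"
  \<comment> \<open>The reflection is a change of one sign, without any spreading.\<close>
  have "norm (\<Sum>k<n. ((if k = j then -1 else 1) * c k) *\<^sub>R \<phi> (id k)) \<le> norm ?x"
    by (rule norm_spread_le) (auto simp: strict_mono_def)
  also have "(\<lambda>k. ((if k = j then -1 else 1) * c k) *\<^sub>R \<phi> (id k)) = (\<lambda>k. (c(j := - c j)) k *\<^sub>R \<phi> k)"
    by auto
  finally have y: "norm ?y \<le> norm ?x" .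
  have "(\<Sum>i<n. (c(j := t)) i *\<^sub>R \<phi> i) = ((1 + s) / 2) *\<^sub>R ?x + ((1 - s) / 2) *\<^sub>R ?y"
    unfolding scaleR_sum_right sum.distrib[symmetric]
    by (rule sum.cong) (auto simp: t scaleR_add_left[symmetric] algebra_simps add_divide_distrib[symmetric]
      diff_divide_distrib[symmetric] simp del: scaleR_add_left)
  also have "norm \<dots> \<le> norm (((1 + s) / 2) *\<^sub>R ?x) + norm (((1 - s) / 2) *\<^sub>R ?y)"
    by (rule norm_triangle_ineq)
  also have "\<dots> = ((1 + s) / 2) * norm ?x + ((1 - s) / 2) * norm ?y"
    using s by simp
  also have "\<dots> \<le> ((1 + s) / 2) * norm ?x + ((1 - s) / 2) * norm ?x"
    using s by (intro add_left_mono mult_left_mono y) auto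
  also have "\<dots> = norm ?x" by (simp add: field_simps)
  finally show ?thesis .
qed

text \<open>The coefficient sequence \<open>b\<close> is turned into \<open>a\<close> one coordinate at a
  time, and no such step increases the norm.\<close>

lemma norm_mono_abs:
  assumes "\<And>i. i < n \<Longrightarrow> \<bar>a i\<bar> \<le> \<bar>b i\<bar>"
  shows "norm (\<Sum>i<n. a i *\<^sub>R \<phi> i) \<le> norm (\<Sum>i<n. b i *\<^sub>R \<phi> i)"
proof -
  have "norm (\<Sum>i<n. (if i < m then a i else b i) *\<^sub>R \<phi> i) \<le> norm (\<Sum>i<n. b i *\<^sub>R \<phi> i)"
    if "m \<le> n" for m
    using that
  proof (induction m)
    case (Suc m)
    let ?c = "\<lambda>i. if i < m then a i else b i"
    have eq: "(\<lambda>i. if i < Suc m then a i else b i) = ?c(m := a m)"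
      by (auto simp: less_Suc_eq)
    have "norm (\<Sum>i<n. (?c(m := a m)) i *\<^sub>R \<phi> i) \<le> norm (\<Sum>i<n. ?c i *\<^sub>R \<phi> i)"
      using Suc.prems assms by (intro norm_shrink_coordinate) auto
    with Suc show ?case by (simp only: eq[THEN fun_cong]) linarith
  qed simp
  from this[of n] show ?thesis by simp
qed

text \<open>The fundamental function of the sequence. Its growth decides whether the sequence behaves like the
  unit vector basis of \<open>l1\<close>.\<close>

definition \<Lambda> :: "nat \<Rightarrow> real" where "\<Lambda> n = norm (\<Sum>i<n. \<phi> i)"

lemma norm_spread_signs_le:
  assumes "strict_mono s" and "\<And>k. \<theta> k \<in> {-1, 1}"
  shows "norm (\<Sum>k<n. \<theta> k *\<^sub>R \<phi> (s k)) \<le> \<Lambda> n"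
  using norm_spread_le[OF assms, where n = n and a = "\<lambda>_. 1"] by (simp add: \<Lambda>_def)

lemma norm_spread_sum_le: "strict_mono s \<Longrightarrow> norm (\<Sum>k<n. \<phi> (s k)) \<le> \<Lambda> n"
  using norm_spread_signs_le[of s "\<lambda>_. 1" n] by simp

lemma \<Lambda>_le: "\<Lambda> n \<le> real n"
  using norm_sum_le_sum_abs[of "\<lambda>_. 1" "{..<n}"] by (simp add: \<Lambda>_def)

lemma norm_le_bounded:
  assumes "\<And>i. i < n \<Longrightarrow> \<bar>a i\<bar> \<le> K" and "K \<ge> 0"
  shows "norm (\<Sum>i<n. a i *\<^sub>R \<phi> i) \<le> K * \<Lambda> n"
proof -
  have "norm (\<Sum>i<n. a i *\<^sub>R \<phi> i) \<le> norm (\<Sum>i<n. K *\<^sub>R \<phi> i)"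
    using assms by (intro norm_mono_abs) simp
  also have "\<dots> = K * \<Lambda> n"
    using assms(2) by (simp add: scaleR_sum_right[symmetric] \<Lambda>_def)
  finally show ?thesis .
qed

text \<open>Coordinates of modulus at most \<open>K\<close> contribute at most \<open>K * \<Lambda> n\<close>. A coordinate of modulus above \<open>K\<close>
  contributes at most its modulus, which is then at most its square divided by \<open>K\<close>. With \<open>K\<close>
  balanced against the Euclidean norm of \<open>a\<close>, sublinear growth of \<open>\<Lambda>\<close> makes the norm small compared
  with what the Cauchy-Schwarz inequality gives for the sum of the moduli.\<close>

lemma norm_le_truncation:
  assumes "K > 0"
  shows "norm (\<Sum>i<n. a i *\<^sub>R \<phi> i) \<le> (\<Sum>i<n. (a i)\<^sup>2) / K + K * \<Lambda> n"
proof -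
  \<comment> \<open>The part of \<open>a\<close> at level \<open>K\<close> and below; the remainder \<open>a i - u i\<close> is either 0 or \<open>a i\<close>.\<close>
  define u where "u i = (if \<bar>a i\<bar> \<le> K then a i else 0)" for i
  have split: "(\<Sum>i<n. a i *\<^sub>R \<phi> i) = (\<Sum>i<n. (a i - u i) *\<^sub>R \<phi> i) + (\<Sum>i<n. u i *\<^sub>R \<phi> i)"
    by (simp add: sum.distrib[symmetric] scaleR_left_diff_distrib)
  have "\<bar>a i - u i\<bar> \<le> (a i)\<^sup>2 / K" for i
  proof -
    have "\<bar>a i\<bar> * K \<le> (a i)\<^sup>2" if "\<bar>a i\<bar> > K"
      using that mult_left_mono[of K "\<bar>a i\<bar>" "\<bar>a i\<bar>"] by (simp add: power2_eq_square abs_mult[symmetric])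
    then show ?thesis using assms by (auto simp: u_def field_simps)
  qed
  then have "(\<Sum>i<n. \<bar>a i - u i\<bar>) \<le> (\<Sum>i<n. (a i)\<^sup>2 / K)"
    by (rule sum_mono)
  with norm_sum_le_sum_abs[of "\<lambda>i. a i - u i" "{..<n}"]
  have "norm (\<Sum>i<n. (a i - u i) *\<^sub>R \<phi> i) \<le> (\<Sum>i<n. (a i)\<^sup>2) / K"
    by (simp add: sum_divide_distrib)
  moreover have "norm (\<Sum>i<n. u i *\<^sub>R \<phi> i) \<le> K * \<Lambda> n"
    using assms by (intro norm_le_bounded) (auto simp: u_def)
  ultimately show ?thesis
    unfolding split using norm_triangle_ineq by (smt (verit))
qed

lemma \<Lambda>_double: "\<Lambda> (2 * n) \<le> 2 * \<Lambda> n"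
proof -
  have "(\<Sum>i<2 * n. \<phi> i) = (\<Sum>i<n. \<phi> i) + (\<Sum>k<n. \<phi> (k + n))"
    using sum_lessThan_add[of \<phi> n n] by (simp add: mult_2)
  then have "\<Lambda> (2 * n) \<le> \<Lambda> n + norm (\<Sum>k<n. \<phi> (k + n))"
    by (simp add: \<Lambda>_def norm_triangle_ineq)
  with norm_spread_sum_le[of "\<lambda>k. k + n" n] show ?thesis by (simp add: strict_mono_def)
qed

lemma \<Lambda>_ratio_antimono:
  assumes "J \<le> j" shows "\<Lambda> (2 ^ j) / 2 ^ j \<le> \<Lambda> (2 ^ J) / 2 ^ J"
  using assms
proof (induction rule: dec_induct)
  case (step j)
  have "\<Lambda> (2 ^ Suc j) / 2 ^ Suc j \<le> \<Lambda> (2 ^ j) / 2 ^ j"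
    using \<Lambda>_double[of "2 ^ j"] by (simp add: field_simps)
  with step show ?case by linarith
qed simp

text \<open>The bound is imposed along powers of two because these are the orders of the Sylvester matrices; a
  limit along them yields \<open>norm_ge_sum_abs\<close>.\<close>

definition linear_growth :: "real \<Rightarrow> bool" where
  "linear_growth c \<longleftrightarrow> c > 0 \<and> (\<forall>j. c * 2 ^ j \<le> \<Lambda> (2 ^ j))"


text \<open>The two sums run over windows that differ in at most \<open>2 * i\<close> positions.\<close>

lemma norm_shift_diff_le: "norm ((\<Sum>t<N. \<phi> (t + i)) - (\<Sum>t<N. \<phi> t)) \<le> 2 * real i"
proof -
  have "(\<Sum>t<i. \<phi> t) + (\<Sum>t<N. \<phi> (t + i)) = (\<Sum>t<N. \<phi> t) + (\<Sum>t<i. \<phi> (t + N))"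
    using sum_lessThan_add[of \<phi> i N] sum_lessThan_add[of \<phi> N i] by (simp add: add.commute[of i])
  then have eq: "(\<Sum>t<N. \<phi> (t + i)) - (\<Sum>t<N. \<phi> t) = (\<Sum>t<i. \<phi> (t + N)) - (\<Sum>t<i. \<phi> t)"
    by (simp add: algebra_simps)
  have "norm (\<Sum>t<i. \<phi> (t + N)) \<le> \<Lambda> i"
    by (rule norm_spread_sum_le) (simp add: strict_mono_def)
  with norm_triangle_ineq4[of "\<Sum>t<i. \<phi> (t + N)" "\<Sum>t<i. \<phi> t"] \<Lambda>_le[of i]
  show ?thesis unfolding eq by (simp add: \<Lambda>_def)
qed

text \<open>Linear growth of the sums with all coefficients equal to one forces a lower \<open>l1\<close> estimate for all
  coefficients. Add up the first \<open>N\<close> translates of \<open>x\<close>, the vector with coefficients \<open>\<bar>a i\<bar>\<close>. Each of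
  them has norm at most that of \<open>x\<close>, while their sum differs from \<open>A\<close> times the sum of the first \<open>N\<close>
  basis vectors, \<open>A\<close> being the sum of the \<open>\<bar>a i\<bar>\<close>, only by boundary terms bounded independently of
  \<open>N\<close>. Dividing by \<open>N\<close> and letting \<open>N\<close> tend to infinity removes the boundary terms.\<close>

lemma norm_ge_sum_abs:
  assumes "linear_growth c"
  shows "c * (\<Sum>i<n. \<bar>a i\<bar>) \<le> norm (\<Sum>i<n. a i *\<^sub>R \<phi> i)"
proof -
  define A where "A = (\<Sum>i<n. \<bar>a i\<bar>)"
  define x where "x = (\<Sum>i<n. \<bar>a i\<bar> *\<^sub>R \<phi> i)"
  have A0: "A \<ge> 0" by (simp add: A_def sum_nonneg)
  have key: "A * \<Lambda> N - 2 * real n * A \<le> real N * norm x" for N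
  proof -
    define b where "b = (\<Sum>t<N. \<Sum>i<n. \<bar>a i\<bar> *\<^sub>R \<phi> (i + t))"
    have "norm (\<Sum>i<n. \<bar>a i\<bar> *\<^sub>R \<phi> (i + t)) \<le> norm x" for t
      using norm_spread_le[of "\<lambda>i. i + t" "\<lambda>_. 1" "\<lambda>i. \<bar>a i\<bar>" n] by (simp add: x_def strict_mono_def)
    then have "norm b \<le> real N * norm x"
      unfolding b_def
      using sum_norm_bound[of "{..<N}" "\<lambda>t. \<Sum>i<n. \<bar>a i\<bar> *\<^sub>R \<phi> (i + t)" "norm x"] by simp
    moreover have "b - A *\<^sub>R (\<Sum>t<N. \<phi> t)
        = (\<Sum>i<n. \<bar>a i\<bar> *\<^sub>R ((\<Sum>t<N. \<phi> (t + i)) - (\<Sum>t<N. \<phi> t)))"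
      unfolding b_def A_def
      by (subst sum.swap) (simp add: scaleR_right_diff_distrib sum_subtractf scaleR_sum_left scaleR_sum_right add.commute, rule sum.swap)
    moreover have "norm \<dots> \<le> (\<Sum>i<n. \<bar>a i\<bar> * (2 * real n))"
      using norm_shift_diff_le by (intro sum_norm_le) (fastforce intro!: mult_left_mono order.trans[OF norm_shift_diff_le])
    moreover have "\<dots> = 2 * real n * A" by (simp add: A_def sum_distrib_right[symmetric])
    moreover have "norm (A *\<^sub>R (\<Sum>t<N. \<phi> t)) = A * \<Lambda> N"
      using A0 by (simp add: \<Lambda>_def)
    ultimately show ?thesis
      using norm_triangle_ineq2[of "A *\<^sub>R (\<Sum>t<N. \<phi> t)" b] norm_minus_commute[of b] by (smt (verit))
  qed
  have "c * A - (2 * real n * A) / 2 ^ j \<le> norm x" for j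
  proof -
    have "c * 2 ^ j \<le> \<Lambda> (2 ^ j)" using assms by (simp add: linear_growth_def)
    from mult_left_mono[OF this A0] key[of "2 ^ j"]
    show ?thesis by (simp add: field_simps)
  qed
  moreover have "(\<lambda>j. c * A - (2 * real n * A) / 2 ^ j) \<longlonglongrightarrow> c * A - 0"
    by (intro tendsto_diff tendsto_const LIMSEQ_divide_realpow_zero) simp
  ultimately have "c * A \<le> norm x"
    by (intro LIMSEQ_le_const2) auto
  also have "\<dots> \<le> norm (\<Sum>i<n. a i *\<^sub>R \<phi> i)"
    unfolding x_def by (intro norm_mono_abs) simp
  finally show ?thesis by (simp add: A_def)
qed

end

section \<open>Column sums of Hadamard matrices\<close>

lemma finite_hadamard_matrices: "finite {H. hadamard_matrix n H}"
proof (rule finite_subset)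
  let ?I = "{..<n} \<times> {..<n}"
  show "finite (mat n n ` (?I \<rightarrow>\<^sub>E {-1, 1 :: real}))"
    by (intro finite_imageI finite_PiE) auto
  show "{H. hadamard_matrix n H} \<subseteq> mat n n ` (?I \<rightarrow>\<^sub>E {-1, 1 :: real})"
  proof
    fix H assume "H \<in> {H. hadamard_matrix n H}"
    then have H: "H \<in> carrier_mat n n" "\<And>k i. k < n \<Longrightarrow> i < n \<Longrightarrow> H $$ (k, i) \<in> {-1, 1}"
      by (auto simp: hadamard_matrix_def)
    have "H = mat n n (restrict (($$) H) ?I)"
      using H(1) by (intro eq_matI) auto
    moreover have "restrict (($$) H) ?I \<in> ?I \<rightarrow>\<^sub>E {-1, 1}"
      using H(2) by (auto simp del: insert_iff)
    ultimately show "H \<in> mat n n ` (?I \<rightarrow>\<^sub>E {-1, 1})" by blast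
  qed
qed

lemma hadamard_entry_square:
  assumes "hadamard_matrix n H" "k < n" "i < n"
  shows "(H $$ (k, i))\<^sup>2 = 1"
proof -
  have "H $$ (k, i) \<in> {-1, 1}" using assms by (simp add: hadamard_matrix_def)
  then show ?thesis by auto
qed

text \<open>Orthogonality of the columns says that the transpose divided by \<open>n\<close> is a left inverse; a left
  inverse of a square matrix is also a right inverse.\<close>

lemma hadamard_rows_orthogonal:
  assumes "hadamard_matrix n H" "k < n" "l < n"
  shows "(\<Sum>i<n. H $$ (k, i) * H $$ (l, i)) = (if k = l then real n else 0)"
proof -
  have H: "H \<in> carrier_mat n n" using assms by (auto simp: hadamard_matrix_def)
  have n: "n > 0" using assms by simp
  let ?B = "(1 / real n) \<cdot>\<^sub>m transpose_mat H"
  have B: "?B \<in> carrier_mat n n" using H by simp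
  have "?B * H = 1\<^sub>m n"
  proof (rule eq_matI)
    fix i j assume ij: "i < dim_row (1\<^sub>m n)" "j < dim_col (1\<^sub>m n)"
    have "(?B * H) $$ (i, j) = (\<Sum>k<n. 1 / real n * (H $$ (k, i) * H $$ (k, j)))"
      using ij H by (simp add: scalar_prod_def lessThan_atLeast0 mult.assoc)
    also have "\<dots> = 1 / real n * scalar_prod (col H i) (col H j)"
      using ij H by (simp add: scalar_prod_def lessThan_atLeast0 sum_distrib_left)
    also have "\<dots> = 1\<^sub>m n $$ (i, j)"
    proof (cases "i = j")
      case True
      have "scalar_prod (col H i) (col H i) = (\<Sum>k<n. (H $$ (k, i))\<^sup>2)"
        using ij H by (simp add: scalar_prod_def lessThan_atLeast0 power2_eq_square)
      also have "\<dots> = (\<Sum>k<n. 1)"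
        using ij by (intro sum.cong refl hadamard_entry_square[OF assms(1)]) auto
      finally show ?thesis using True ij n by simp
    next
      case False
      then show ?thesis using ij assms(1) by (simp add: hadamard_matrix_def)
    qed
    finally show "(?B * H) $$ (i, j) = 1\<^sub>m n $$ (i, j)" .
  qed (use H in auto)
  from mat_mult_left_right_inverse[OF B H this]
  have "(H * ?B) $$ (k, l) = 1\<^sub>m n $$ (k, l)" by simp
  moreover have "(H * ?B) $$ (k, l) = (\<Sum>i<n. H $$ (k, i) * H $$ (l, i)) / real n"
    using H assms by (simp add: scalar_prod_def lessThan_atLeast0 sum_divide_distrib)
  ultimately show ?thesis using n assms by (auto simp: field_simps split: if_splits)
qed

text \<open>Parseval: the sum of the first \<open>m\<close> rows is a sum of \<open>m\<close> orthogonal vectors of squared length \<open>n\<close>.\<close>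

lemma hadamard_partial_sums_square:
  assumes "hadamard_matrix n H" "m \<le> n"
  shows "(\<Sum>i<n. (\<Sum>k<m. H $$ (k, i))\<^sup>2) = real m * real n"
proof -
  have "(\<Sum>i<n. (\<Sum>k<m. H $$ (k, i))\<^sup>2) = (\<Sum>i<n. \<Sum>k<m. \<Sum>l<m. H $$ (k, i) * H $$ (l, i))"
    by (simp add: power2_eq_square sum_product)
  also have "\<dots> = (\<Sum>k<m. \<Sum>i<n. \<Sum>l<m. H $$ (k, i) * H $$ (l, i))"
    by (rule sum.swap)
  also have "\<dots> = (\<Sum>k<m. \<Sum>l<m. \<Sum>i<n. H $$ (k, i) * H $$ (l, i))"
    by (intro sum.cong refl sum.swap)
  also have "\<dots> = (\<Sum>k<m. \<Sum>l<m. if k = l then real n else 0)"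
    using assms by (intro sum.cong refl hadamard_rows_orthogonal) auto
  also have "\<dots> = real m * real n" by simp
  finally show ?thesis .
qed

lemma hadamard_flip_rows:
  assumes "hadamard_matrix n H" and "\<And>k. \<theta> k \<in> {-1, 1}"
  shows "hadamard_matrix n (mat n n (\<lambda>(k, i). \<theta> k * H $$ (k, i)))"
proof -
  have sq: "\<theta> k * \<theta> k = 1" for k using assms(2)[of k] by auto
  have H: "H \<in> carrier_mat n n" using assms by (auto simp: hadamard_matrix_def)
  have "scalar_prod (col (mat n n (\<lambda>(k, i). \<theta> k * H $$ (k, i))) i)
      (col (mat n n (\<lambda>(k, i). \<theta> k * H $$ (k, i))) j) = scalar_prod (col H i) (col H j)"
    if "i < n" "j < n" for i j
    using that H sq by (auto simp: scalar_prod_def algebra_simps intro!: sum.cong)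
  moreover have "\<theta> k * H $$ (k, i) \<in> {-1, 1}" if "k < n" "i < n" for k i
  proof -
    have "H $$ (k, i) \<in> {-1, 1}" using assms(1) that by (simp add: hadamard_matrix_def)
    then show ?thesis using assms(2)[of k] by auto
  qed
  ultimately show ?thesis
    using assms(1) by (simp add: hadamard_matrix_def)
qed

text \<open>The conditional expectation of \<open>12 * n * X\<^sup>2 - X ^ 4\<close>, where \<open>X\<close> is obtained from the current sum
  \<open>S\<close> by adding \<open>r\<close> further independent random signs: the second and fourth moments of such an \<open>X\<close>
  are \<open>S\<^sup>2 + r\<close> and the expression in parentheses. The parameter \<open>r\<close> is real so that
  no truncated subtraction intervenes.\<close>

definition fourth_moment_potential :: "real \<Rightarrow> real \<Rightarrow> real \<Rightarrow> real" where
  "fourth_moment_potential n r S = 12 * n * (S\<^sup>2 + r) - (S ^ 4 + 6 * r * S\<^sup>2 + 3 * r\<^sup>2 - 2 * r)"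

text \<open>The martingale property: averaging over the next sign preserves the conditional expectation.\<close>

lemma fourth_moment_potential_step:
  assumes "h\<^sup>2 = 1"
  shows "fourth_moment_potential n r (S + h) + fourth_moment_potential n r (S - h)
    = 2 * fourth_moment_potential n (r + 1) S"
proof -
  have "h ^ 4 = (h\<^sup>2)\<^sup>2" by simp
  then have h4: "h ^ 4 = 1" by (simp only: assms) simp
  have "(S + h) ^ 4 + (S - h) ^ 4 = 2 * S ^ 4 + 12 * S\<^sup>2 * h\<^sup>2 + 2 * h ^ 4"
    and "(S + h)\<^sup>2 + (S - h)\<^sup>2 = 2 * S\<^sup>2 + 2 * h\<^sup>2"
    by (simp_all add: eval_nat_numeral algebra_simps)
  with assms h4 have "(S + h) ^ 4 = 2 * S ^ 4 + 12 * S\<^sup>2 + 2 - (S - h) ^ 4"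
    and "(S + h)\<^sup>2 = 2 * S\<^sup>2 + 2 - (S - h)\<^sup>2" by simp_all
  then show ?thesis
    unfolding fourth_moment_potential_def by (simp add: algebra_simps power2_eq_square)
qed

text \<open>The method of conditional expectations: the two choices of the next sign average to the current
  value of the total potential, hence one of them does not decrease it.\<close>

lemma exists_signs_large_potential:
  fixes h :: "nat \<Rightarrow> nat \<Rightarrow> real"
  assumes h: "\<And>k i. k < n \<Longrightarrow> i < p \<Longrightarrow> (h k i)\<^sup>2 = 1" and "m \<le> n"
  shows "\<exists>\<theta>. (\<forall>k. \<theta> k \<in> {-1, 1 :: real}) \<and>
    real p * fourth_moment_potential N (real n) 0
      \<le> (\<Sum>i<p. fourth_moment_potential N (real n - real m) (\<Sum>k<m. \<theta> k * h k i))"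
  using \<open>m \<le> n\<close>
proof (induction m)
  case 0
  show ?case by (rule exI[of _ "\<lambda>_. 1"]) simp
next
  case (Suc m)
  then obtain \<theta> where \<theta>: "\<And>k. \<theta> k \<in> {-1, 1 :: real}" and le:
    "real p * fourth_moment_potential N (real n) 0
      \<le> (\<Sum>i<p. fourth_moment_potential N (real n - real m) (\<Sum>k<m. \<theta> k * h k i))" by auto
  define S where "S i = (\<Sum>k<m. \<theta> k * h k i)" for i
  let ?Q = "fourth_moment_potential N (real n - real (Suc m))"
  have S: "(\<Sum>k<Suc m. (\<theta>(m := e)) k * h k i) = S i + e * h m i" for e i
    by (simp add: S_def)
  have "(\<Sum>i<p. ?Q (S i + h m i)) + (\<Sum>i<p. ?Q (S i - h m i))
      = (\<Sum>i<p. 2 * fourth_moment_potential N (real n - real m) (S i))"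
    unfolding sum.distrib[symmetric] using Suc.prems
    by (intro sum.cong refl) (simp add: fourth_moment_potential_step h)
  with le have "real p * fourth_moment_potential N (real n) 0 \<le> (\<Sum>i<p. ?Q (S i + 1 * h m i))
    \<or> real p * fourth_moment_potential N (real n) 0 \<le> (\<Sum>i<p. ?Q (S i + (-1) * h m i))"
    unfolding sum_distrib_left[symmetric] S_def by simp linarith
  then obtain e where e: "e \<in> {-1, 1}" "real p * fourth_moment_potential N (real n) 0 \<le> (\<Sum>i<p. ?Q (S i + e * h m i))"
    by blast
  show ?case
  proof (intro exI[of _ "\<theta>(m := e)"] conjI allI)
    show "(\<theta>(m := e)) k \<in> {-1, 1}" for k using e(1) \<theta>[of k] by simp
  qed (simp only: S e(2))
qed

text \<open>The difference of the two sides is \<open>v * (v - 2 * s)\<^sup>2 * (v + 4 * s)\<close> with \<open>v = \<bar>S\<bar>\<close>.\<close>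

lemma fourth_moment_inequality:
  fixes s S :: real
  assumes "s \<ge> 0"
  shows "12 * s\<^sup>2 * S\<^sup>2 - S ^ 4 \<le> 16 * s ^ 3 * \<bar>S\<bar>"
proof -
  have "0 \<le> \<bar>S\<bar> * (\<bar>S\<bar> - 2 * s)\<^sup>2 * (\<bar>S\<bar> + 4 * s)" using assms by simp
  also have "\<dots> = \<bar>S\<bar> ^ 4 - 12 * s\<^sup>2 * \<bar>S\<bar>\<^sup>2 + 16 * s ^ 3 * \<bar>S\<bar>"
    by (simp add: power2_eq_square eval_nat_numeral algebra_simps del: abs_mult_self_eq)
  finally show ?thesis by simp
qed

text \<open>Khintchine's inequality for the first absolute moment, in the form of the existence of a good choice
  of signs. By the preceding inequality the first moment is bounded below through the second and
  fourth moments, and with \<open>s = sqrt n\<close> the potential at the start is at least \<open>9 * s ^ 4\<close> per column.\<close>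

lemma exists_signs_sum_abs_ge:
  fixes h :: "nat \<Rightarrow> nat \<Rightarrow> real"
  assumes "\<And>k i. k < n \<Longrightarrow> i < p \<Longrightarrow> (h k i)\<^sup>2 = 1"
  obtains \<theta> where "\<And>k. \<theta> k \<in> {-1, 1 :: real}"
    and "9 / 16 * real p * sqrt (real n) \<le> (\<Sum>i<p. \<bar>\<Sum>k<n. \<theta> k * h k i\<bar>)"
proof -
  obtain \<theta> where \<theta>: "\<And>k. \<theta> k \<in> {-1, 1 :: real}" and le:
    "real p * fourth_moment_potential (real n) (real n) 0
      \<le> (\<Sum>i<p. fourth_moment_potential (real n) 0 (\<Sum>k<n. \<theta> k * h k i))"
    using exists_signs_large_potential[of n p h n "real n"] assms by auto
  define s where "s = sqrt (real n)"
  have s: "s \<ge> 0" "real n = s\<^sup>2" by (simp_all add: s_def)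
  have "9 * real p * s ^ 4 \<le> real p * fourth_moment_potential (real n) (real n) 0"
    by (simp add: fourth_moment_potential_def s power2_eq_square algebra_simps eval_nat_numeral)
  also have "\<dots> \<le> (\<Sum>i<p. 16 * s ^ 3 * \<bar>\<Sum>k<n. \<theta> k * h k i\<bar>)"
    using fourth_moment_inequality[OF s(1)]
    by (intro order.trans[OF le] sum_mono) (simp add: fourth_moment_potential_def s(2))
  also have "\<dots> = 16 * s ^ 3 * (\<Sum>i<p. \<bar>\<Sum>k<n. \<theta> k * h k i\<bar>)"
    by (simp add: sum_distrib_left)
  finally have main: "s ^ 3 * (9 * real p * s) \<le> s ^ 3 * (16 * (\<Sum>i<p. \<bar>\<Sum>k<n. \<theta> k * h k i\<bar>))"
    by (simp add: eval_nat_numeral algebra_simps)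
  have "9 * real p * s \<le> 16 * (\<Sum>i<p. \<bar>\<Sum>k<n. \<theta> k * h k i\<bar>)"
  proof (cases "s = 0")
    case True
    then show ?thesis by (simp add: sum_nonneg)
  next
    case False
    then have "s ^ 3 > 0" using s(1) by simp
    with main show ?thesis by (simp only: mult_le_cancel_left_pos)
  qed
  with \<theta> show ?thesis by (intro that[of \<theta>]) (simp_all add: s_def)
qed

section \<open>Sylvester matrices and Walsh-Dirichlet kernels\<close>

lemma sylvester_carrier: "sylvester n \<in> carrier_mat (2 ^ n) (2 ^ n)"
proof (induction n rule: sylvester.induct)
  case 2
  show ?case by (intro carrier_matI) (simp_all add: mat_of_rows_list_def)
next
  case (3 n)
  then show ?case by (auto intro!: carrier_matI)
qed simp

text \<open>The recursion also holds at the conventional start, the matrix of order one.\<close>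

lemma sylvester_Suc:
  "sylvester (Suc n) = four_block_mat (sylvester n) (sylvester n) (sylvester n) (- sylvester n)"
proof (cases n)
  case 0
  show ?thesis
  proof (rule eq_matI)
    let ?M = "four_block_mat (sylvester n) (sylvester n) (sylvester n) (- sylvester n)"
    fix i j assume "i < dim_row ?M" "j < dim_col ?M"
    then have "i = 0 \<or> i = 1" "j = 0 \<or> j = 1" using 0 by auto
    then show "sylvester (Suc n) $$ (i, j) = ?M $$ (i, j)"
      by (auto simp: 0 mat_of_rows_list_def)
  qed (simp_all add: 0 mat_of_rows_list_def)
qed simp

abbreviation walsh :: "nat \<Rightarrow> nat \<Rightarrow> nat \<Rightarrow> real" where
  "walsh n k i \<equiv> sylvester n $$ (k, i)"

lemma walsh_Suc:
  assumes "k < 2 ^ n" "i < 2 ^ n"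
  shows "walsh (Suc n) k i = walsh n k i" "walsh (Suc n) k (2 ^ n + i) = walsh n k i"
    "walsh (Suc n) (2 ^ n + k) i = walsh n k i" "walsh (Suc n) (2 ^ n + k) (2 ^ n + i) = - walsh n k i"
  using assms sylvester_carrier[of n] by (auto simp: sylvester_Suc simp del: sylvester.simps)

lemma less_power2_Suc_cases:
  fixes i :: nat
  assumes "i < 2 ^ Suc n"
  obtains "i < 2 ^ n" | j where "i = 2 ^ n + j" "j < 2 ^ n"
proof (cases "i < 2 ^ n")
  case False
  then have "i = 2 ^ n + (i - 2 ^ n)" "i - 2 ^ n < 2 ^ n" using assms by auto
  with that(2) show ?thesis by blast
qed (use that in auto)

lemma sum_power2_Suc:
  fixes f :: "nat \<Rightarrow> real"
  shows "sum f {..<2 ^ Suc n} = sum f {..<2 ^ n} + (\<Sum>i<2 ^ n. f (2 ^ n + i))"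
  using sum_lessThan_add[of f "2 ^ n" "2 ^ n"] by (simp add: mult_2 add.commute)

text \<open>In the induction step the inner product of two columns is a sum over the two row blocks. It vanishes
  by induction if the columns differ modulo \<open>2 ^ n\<close>; otherwise the two blocks cancel.\<close>

lemma hadamard_sylvester: "hadamard_matrix (2 ^ n) (sylvester n)"
proof -
  have entries: "walsh n k i \<in> {-1, 1}" if "k < 2 ^ n" "i < 2 ^ n" for k i
    using that
  proof (induction n arbitrary: k i)
    case (Suc n)
    show ?case
      by (rule less_power2_Suc_cases[OF Suc.prems(1)]; rule less_power2_Suc_cases[OF Suc.prems(2)])
        (use Suc.IH in \<open>auto simp: walsh_Suc simp del: sylvester.simps\<close>)
  qed simp
  have "(\<Sum>k<2 ^ n. walsh n k i * walsh n k j) = 0" if "i < 2 ^ n" "j < 2 ^ n" "i \<noteq> j" for i j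
    using that
  proof (induction n arbitrary: i j)
    case (Suc n)
    show ?case
      by (rule less_power2_Suc_cases[OF Suc.prems(1)]; rule less_power2_Suc_cases[OF Suc.prems(2)])
        (use Suc.IH Suc.prems(3) in \<open>auto simp: sum_power2_Suc walsh_Suc sum_negf
          simp del: sylvester.simps power_Suc\<close>)
  qed simp
  with entries sylvester_carrier[of n] show ?thesis
    by (auto simp: hadamard_matrix_def scalar_prod_def lessThan_atLeast0)
qed

text \<open>The rows of a Sylvester matrix are discretised Walsh functions, so the sums of their initial segments
  are Dirichlet kernels of the Walsh system, and \<open>walsh_lebesgue\<close> is a Lebesgue constant without the
  normalising factor.\<close>

definition walsh_dirichlet :: "nat \<Rightarrow> nat \<Rightarrow> nat \<Rightarrow> real" where
  "walsh_dirichlet n m i = (\<Sum>k<m. walsh n k i)"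

lemma walsh_dirichlet_Suc_low:
  assumes "m \<le> 2 ^ n" "i < 2 ^ n"
  shows "walsh_dirichlet (Suc n) m i = walsh_dirichlet n m i"
    "walsh_dirichlet (Suc n) m (2 ^ n + i) = walsh_dirichlet n m i"
  unfolding walsh_dirichlet_def using assms
  by (auto intro!: sum.cong simp: walsh_Suc simp del: sylvester.simps)

lemma walsh_dirichlet_Suc_high:
  assumes "m \<le> 2 ^ n" "i < 2 ^ n"
  shows "walsh_dirichlet (Suc n) (2 ^ n + m) i = walsh_dirichlet n (2 ^ n) i + walsh_dirichlet n m i"
    "walsh_dirichlet (Suc n) (2 ^ n + m) (2 ^ n + i) = walsh_dirichlet n (2 ^ n) i - walsh_dirichlet n m i"
proof -
  have "walsh_dirichlet (Suc n) (2 ^ n + m) j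
      = walsh_dirichlet (Suc n) (2 ^ n) j + (\<Sum>k<m. walsh (Suc n) (2 ^ n + k) j)" for j
    unfolding walsh_dirichlet_def by (induction m) (simp_all del: sylvester.simps)
  moreover have "(\<Sum>k<m. walsh (Suc n) (2 ^ n + k) i) = walsh_dirichlet n m i"
    unfolding walsh_dirichlet_def using assms by (intro sum.cong refl) (simp add: walsh_Suc)
  moreover have "(\<Sum>k<m. walsh (Suc n) (2 ^ n + k) (2 ^ n + i)) = - walsh_dirichlet n m i"
    unfolding walsh_dirichlet_def sum_negf[symmetric] using assms
    by (intro sum.cong refl) (simp add: walsh_Suc)
  ultimately show "walsh_dirichlet (Suc n) (2 ^ n + m) i = walsh_dirichlet n (2 ^ n) i + walsh_dirichlet n m i"
    "walsh_dirichlet (Suc n) (2 ^ n + m) (2 ^ n + i) = walsh_dirichlet n (2 ^ n) i - walsh_dirichlet n m i"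
    using assms by (simp_all add: walsh_dirichlet_Suc_low)
qed

lemma walsh_dirichlet_full:
  "i < 2 ^ n \<Longrightarrow> walsh_dirichlet n (2 ^ n) i = (if i = 0 then 2 ^ n else 0)"
proof (induction n arbitrary: i)
  case (Suc n)
  have eq: "walsh_dirichlet (Suc n) (2 ^ Suc n) i = walsh_dirichlet (Suc n) (2 ^ n + 2 ^ n) i"
    by (simp add: mult_2)
  show ?case
    unfolding eq
    by (rule less_power2_Suc_cases[OF Suc.prems])
      (use Suc.IH in \<open>auto simp: walsh_dirichlet_Suc_high\<close>)
qed (simp add: walsh_dirichlet_def)

lemma walsh_dirichlet_column_0: "m \<le> 2 ^ n \<Longrightarrow> walsh_dirichlet n m 0 = real m"
proof -
  have "k < 2 ^ n \<Longrightarrow> walsh n k 0 = 1" for k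
  proof (induction n arbitrary: k)
    case (Suc n)
    show ?case
      by (rule less_power2_Suc_cases[OF Suc.prems])
        (use Suc.IH walsh_Suc[of _ n 0] in \<open>auto simp del: sylvester.simps\<close>)
  qed simp
  then show "m \<le> 2 ^ n \<Longrightarrow> walsh_dirichlet n m 0 = real m" by (simp add: walsh_dirichlet_def)
qed

definition walsh_lebesgue :: "nat \<Rightarrow> nat \<Rightarrow> real" where
  "walsh_lebesgue n m = (\<Sum>i<2 ^ n. \<bar>walsh_dirichlet n m i\<bar>)"

lemma walsh_lebesgue_Suc_low:
  assumes "m \<le> 2 ^ n" shows "walsh_lebesgue (Suc n) m = 2 * walsh_lebesgue n m"
  using assms by (simp add: walsh_lebesgue_def sum_power2_Suc walsh_dirichlet_Suc_low del: power_Suc)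

text \<open>The kernel of order \<open>2 ^ n\<close> is concentrated in column 0, where the kernel of order \<open>m\<close> has the value
  \<open>m\<close>. In every other column the two halves just repeat the kernel of order \<open>m\<close> up to sign, and in
  column 0 the moduli \<open>2 ^ n + m\<close> and \<open>2 ^ n - m\<close> add up to \<open>2 ^ Suc n\<close>.\<close>

lemma walsh_lebesgue_Suc_high:
  assumes "m \<le> 2 ^ n"
  shows "walsh_lebesgue (Suc n) (2 ^ n + m) = 2 ^ Suc n + 2 * walsh_lebesgue n m - 2 * real m"
proof -
  let ?D = "\<lambda>i. walsh_dirichlet n m i"
  have m: "real m \<le> 2 ^ n"
    using assms by (metis of_nat_le_iff of_nat_numeral of_nat_power)
  have "walsh_lebesgue (Suc n) (2 ^ n + m)
      = (\<Sum>i<2 ^ n. \<bar>walsh_dirichlet n (2 ^ n) i + ?D i\<bar> + \<bar>walsh_dirichlet n (2 ^ n) i - ?D i\<bar>)"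
    unfolding sum.distrib
    using assms by (simp add: walsh_lebesgue_def sum_power2_Suc walsh_dirichlet_Suc_high del: power_Suc)
  also have "\<dots> = (\<Sum>i<2 ^ n. 2 * \<bar>?D i\<bar> + (if i = 0 then 2 ^ Suc n - 2 * real m else 0))"
    using assms m by (intro sum.cong refl) (simp add: walsh_dirichlet_full walsh_dirichlet_column_0)
  also have "\<dots> = 2 * walsh_lebesgue n m + (2 ^ Suc n - 2 * real m)"
    unfolding sum.distrib by (simp add: walsh_lebesgue_def sum_distrib_left)
  finally show ?thesis by simp
qed

text \<open>The order \<open>m\<close> is taken with alternating binary digits: passing from \<open>m\<close> to \<open>2 ^ Suc n + m\<close> skips one
  level, which keeps the loss \<open>2 * real m\<close> at most half of the gain \<open>2 ^ Suc (Suc n)\<close>.\<close>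

lemma exists_large_walsh_lebesgue:
  "\<exists>m\<in>{1..2 ^ n}. real n * 2 ^ n \<le> 4 * walsh_lebesgue n m"
proof (induction n rule: induct_nat_012)
  case 0
  show ?case by (simp add: walsh_lebesgue_def sum_nonneg)
next
  case 1
  have "walsh_lebesgue (Suc 0) 1 = 2"
    by (subst walsh_lebesgue_Suc_low) (simp_all add: walsh_lebesgue_def walsh_dirichlet_def)
  then show ?case by (intro bexI[of _ 1]) simp_all
next
  case (ge2 n)
  then obtain m where m: "1 \<le> m" "m \<le> 2 ^ n" and le: "real n * 2 ^ n \<le> 4 * walsh_lebesgue n m"
    by auto
  let ?m = "2 ^ Suc n + m"
  have "walsh_lebesgue (Suc (Suc n)) ?m = 2 ^ Suc (Suc n) + 4 * walsh_lebesgue n m - 2 * real m"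
    using m by (subst walsh_lebesgue_Suc_high) (simp_all add: walsh_lebesgue_Suc_low)
  moreover have "real m \<le> 2 ^ n"
    using m(2) by (metis of_nat_le_iff of_nat_numeral of_nat_power)
  moreover have "real (Suc (Suc n)) * 2 ^ Suc (Suc n) = 4 * (real n * 2 ^ n) + 8 * 2 ^ n"
    "(2::real) ^ Suc (Suc n) = 4 * 2 ^ n"
    by (simp_all add: algebra_simps)
  ultimately have "real (Suc (Suc n)) * 2 ^ Suc (Suc n) \<le> 4 * walsh_lebesgue (Suc (Suc n)) ?m"
    using le by linarith
  then show ?case using m by (intro bexI[of _ ?m]) auto
qed

text \<open>Splitting the first \<open>m\<close> rows into blocks according to the binary digits of \<open>m\<close>, the block of length
  \<open>2 ^ k\<close> contributes up to sign the kernel of order \<open>2 ^ k\<close>, which is \<open>2 ^ k\<close> on the multiples of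
  \<open>2 ^ k\<close> and 0 elsewhere. The term 1 accounts for the case in which \<open>m\<close> is the full number of rows.\<close>

lemma abs_walsh_dirichlet_le:
  "m \<le> 2 ^ n \<Longrightarrow> i < 2 ^ n \<Longrightarrow>
    \<bar>walsh_dirichlet n m i\<bar> \<le> 1 + (\<Sum>k<n. if 2 ^ k dvd i then 2 ^ k else 0)"
proof (induction n arbitrary: m i)
  case 0
  then have "m = 0 \<or> m = 1" by auto
  with 0 show ?case by (auto simp: walsh_dirichlet_def)
next
  case (Suc n)
  let ?B = "\<lambda>n i. 1 + (\<Sum>k<n. if 2 ^ k dvd i then 2 ^ k else 0) :: real"
  obtain j where j: "j < 2 ^ n" "i = j \<or> i = 2 ^ n + j"
    using less_power2_Suc_cases[OF Suc.prems(2)] by metis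
  have B: "?B (Suc n) i = ?B n j + (if j = 0 then 2 ^ n else 0)"
  proof -
    have "2 ^ k dvd i \<longleftrightarrow> 2 ^ k dvd j" if "k \<le> n" for k
      using j(2) that le_imp_power_dvd[OF that, of "2::nat"] by (auto simp: dvd_add_right_iff)
    moreover have "2 ^ n dvd j \<longleftrightarrow> j = 0"
      using j(1) by (auto dest: dvd_imp_le)
    ultimately show ?thesis by simp
  qed
  show ?case
  proof (cases "m \<le> 2 ^ n")
    case True
    then have "\<bar>walsh_dirichlet (Suc n) m i\<bar> = \<bar>walsh_dirichlet n m j\<bar>"
      using j by (auto simp: walsh_dirichlet_Suc_low)
    also have "\<dots> \<le> ?B n j" by (rule Suc.IH[OF True j(1)])
    also have "\<dots> \<le> ?B (Suc n) i" unfolding B by simp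
    finally show ?thesis .
  next
    case False
    define m' where "m' = m - 2 ^ n"
    have m': "m = 2 ^ n + m'" "m' \<le> 2 ^ n"
      using False Suc.prems(1) by (auto simp: m'_def)
    have "\<bar>walsh_dirichlet (Suc n) m i\<bar> \<le> \<bar>walsh_dirichlet n (2 ^ n) j\<bar> + \<bar>walsh_dirichlet n m' j\<bar>"
      using j m' by (auto simp: walsh_dirichlet_Suc_high)
    also have "\<dots> \<le> (if j = 0 then 2 ^ n else 0) + ?B n j"
      using Suc.IH[OF m'(2) j(1)] j(1) by (simp add: walsh_dirichlet_full)
    also have "\<dots> = ?B (Suc n) i" unfolding B by simp
    finally show ?thesis .
  qed
qed

section \<open>Copies of l1\<close>

lemma bounded_linear_l1_nth: "bounded_linear (\<lambda>x. l1_nth x j)"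
proof (rule bounded_linear_intro[where K = 1])
  fix x :: l1
  have "\<bar>l1_nth x j\<bar> \<le> (\<Sum>i. \<bar>l1_nth x i\<bar>)"
    using sum_le_suminf[of "\<lambda>i. \<bar>l1_nth x i\<bar>" "{j}"] l1_nth[of x] by simp
  then show "norm (l1_nth x j) \<le> norm x * 1" by (simp add: norm_l1.rep_eq)
qed (simp_all add: plus_l1.rep_eq scaleR_l1.rep_eq)

lemma summable_l1_nth: "summable (\<lambda>i. \<bar>l1_nth x i\<bar>)"
  using l1_nth[of x] by simp

text \<open>Cut at an index \<open>M\<close> beyond which \<open>y\<close> is almost zero. Up to \<open>M\<close> the vectors \<open>x i\<close> are eventually
  almost zero, so \<open>y\<close> and \<open>x i\<close> are almost disjointly supported, and the \<open>l1\<close> norm is additive on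
  disjoint supports.\<close>

lemma eventually_norm_add_l1_ge:
  fixes x :: "nat \<Rightarrow> l1"
  assumes null: "\<And>j. (\<lambda>i. l1_nth (x i) j) \<longlonglongrightarrow> 0" and "e > 0"
  shows "\<forall>\<^sub>F i in sequentially. norm y + norm (x i) - e \<le> norm (y + x i)"
proof -
  define head where "head M z = (\<Sum>j<M. \<bar>l1_nth z j\<bar>)" for M z
  define tail where "tail M z = (\<Sum>j. \<bar>l1_nth z (j + M)\<bar>)" for M z
  have norm_split: "norm z = head M z + tail M z" for M z
    unfolding norm_l1.rep_eq head_def tail_def
    using suminf_split_initial_segment[OF summable_l1_nth, of z M] by simp
  have summable_tail: "summable (\<lambda>j. \<bar>l1_nth z (j + M)\<bar>)" for M z
    by (rule summable_ignore_initial_segment[OF summable_l1_nth])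
  obtain M where "norm (\<Sum>j. \<bar>l1_nth y (j + M)\<bar>) < e / 4"
    using suminf_exist_split[OF _ summable_l1_nth[of y], of "e / 4"] \<open>e > 0\<close> by auto
  then have M: "tail M y < e / 4" by (simp add: tail_def)
  have head_le: "head M y \<le> head M (y + z) + head M z" for z
    unfolding head_def sum.distrib[symmetric] by (intro sum_mono) (simp add: plus_l1.rep_eq)
  have tail_le: "tail M z \<le> tail M (y + z) + tail M y" for z
    unfolding tail_def suminf_add[OF summable_tail summable_tail]
    by (intro suminf_le summable_add summable_tail) (simp add: plus_l1.rep_eq)
  have "(\<lambda>i. head M (x i)) \<longlonglongrightarrow> (\<Sum>j<M. \<bar>0\<bar>)"
    unfolding head_def by (intro tendsto_sum tendsto_rabs null)
  then have "\<forall>\<^sub>F i in sequentially. head M (x i) < e / 4"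
    using \<open>e > 0\<close> by (intro order_tendstoD(2)) auto
  then show ?thesis
  proof eventually_elim
    case (elim i)
    with M head_le[of "x i"] tail_le[of "x i"] show ?case
      unfolding norm_split[of _ M] by linarith
  qed
qed

context one_subsymmetric_sequence
begin

text \<open>Evaluate \<open>f\<close> at a signed sum of \<open>n\<close> basis vectors on each of which it has modulus at least \<open>r\<close>.\<close>

lemma growth_of_nonnull_functional:
  fixes f :: "'a \<Rightarrow> real"
  assumes f: "linear f" and K: "\<And>x. \<bar>f x\<bar> \<le> K * norm x" "K \<ge> 0"
    and inf: "infinite {i. r \<le> \<bar>f (\<phi> i)\<bar>}"
  shows "r * real n \<le> K * \<Lambda> n"
proof -
  define s where "s = enumerate {i. r \<le> \<bar>f (\<phi> i)\<bar>}"
  define \<theta> where "\<theta> k = (if f (\<phi> (s k)) \<ge> 0 then 1 else -1 :: real)" for k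
  have s: "strict_mono s" unfolding s_def by (rule strict_mono_enumerate[OF inf])
  have r: "r \<le> \<bar>f (\<phi> (s k))\<bar>" for k
    using enumerate_in_set[OF inf, of k] by (simp add: s_def)
  have \<theta>_abs: "\<theta> k * f (\<phi> (s k)) = \<bar>f (\<phi> (s k))\<bar>" for k
    by (simp add: \<theta>_def)
  have "r * real n = (\<Sum>k<n. r)" by simp
  also have "\<dots> \<le> (\<Sum>k<n. \<theta> k * f (\<phi> (s k)))"
    using r by (intro sum_mono) (simp add: \<theta>_abs)
  also have "\<dots> = f (\<Sum>k<n. \<theta> k *\<^sub>R \<phi> (s k))"
    by (simp add: linear_sum[OF f] linear_cmul[OF f])
  also have "\<dots> \<le> K * norm (\<Sum>k<n. \<theta> k *\<^sub>R \<phi> (s k))"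
    using K(1) by (meson abs_le_D1)
  also have "\<dots> \<le> K * \<Lambda> n"
    by (intro mult_left_mono norm_spread_signs_le s K(2)) (simp add: \<theta>_def)
  finally show ?thesis .
qed

text \<open>Each vector is chosen so far out that, by the previous estimate, it adds all but half of \<open>\<eta>\<close> of its
  own norm to that of the sum built so far.\<close>

lemma gliding_hump:
  fixes x :: "nat \<Rightarrow> l1"
  assumes null: "\<And>j. (\<lambda>i. l1_nth (x i) j) \<longlonglongrightarrow> 0"
    and lower: "\<And>i. \<eta> \<le> norm (x i)" and "\<eta> > 0"
  shows "\<exists>s. strict_mono s \<and> real n * (\<eta> / 2) \<le> norm (\<Sum>k<n. x (s k))"
proof (induction n)
  case 0
  show ?case by (rule exI[of _ id]) (simp add: strict_mono_def)
next
  case (Suc n)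
  then obtain s where s: "strict_mono s" and le: "real n * (\<eta> / 2) \<le> norm (\<Sum>k<n. x (s k))"
    by blast
  let ?y = "\<Sum>k<n. x (s k)"
  from eventually_norm_add_l1_ge[OF null, of "\<eta> / 2" ?y] \<open>\<eta> > 0\<close>
  obtain N where N: "\<And>i. i \<ge> N \<Longrightarrow> norm ?y + norm (x i) - \<eta> / 2 \<le> norm (?y + x i)"
    by (auto simp: eventually_sequentially)
  \<comment> \<open>Adding \<open>s n\<close> keeps the new indices above all those used before.\<close>
  define i where "i = N + s n"
  define s' where "s' k = (if k < n then s k else i + k)" for k
  have "strict_mono s'"
  proof (rule strict_monoI)
    fix k l :: nat assume "k < l"
    have less: "s k < s n" if "k < n" using s that by (simp add: strict_mono_less)
    show "s' k < s' l"
    proof (cases "l < n")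
      case True
      with \<open>k < l\<close> s show ?thesis by (simp add: s'_def strict_mono_less)
    next
      case False
      with \<open>k < l\<close> less show ?thesis by (auto simp: s'_def i_def)
    qed
  qed
  moreover have "real (Suc n) * (\<eta> / 2) \<le> norm (\<Sum>k<Suc n. x (s' k))"
  proof -
    have "(\<Sum>k<Suc n. x (s' k)) = ?y + x (i + n)" by (simp add: s'_def)
    moreover have "norm ?y + norm (x (i + n)) - \<eta> / 2 \<le> norm (?y + x (i + n))"
      by (rule N) (simp add: i_def)
    ultimately show ?thesis using le lower[of "i + n"] by (simp add: algebra_simps)
  qed
  ultimately show ?case by blast
qed

text \<open>Let \<open>T\<close> be an isomorphism onto \<open>l1\<close>. If some coordinate of \<open>T (\<phi> i)\<close> does not tend to zero, that
  coordinate is a functional that forces linear growth. If all coordinates tend to zero, the images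
  contain almost disjoint vectors with norms bounded away from zero, and their sums grow linearly
  in \<open>l1\<close>.\<close>

lemma linear_growth_if_isomorphic_l1:
  assumes "isomorphic_spaces TYPE('a) TYPE(l1)"
  shows "\<exists>c. linear_growth c"
proof -
  obtain T :: "'a \<Rightarrow> l1" where T: "bounded_linear T" "bij T" "bounded_linear (inv_into UNIV T)"
    using assms unfolding isomorphic_spaces_def by blast
  obtain K where K: "K > 0" "\<And>x. norm (T x) \<le> norm x * K"
    using bounded_linear.pos_bounded[OF T(1)] by blast
  obtain K' where K': "K' > 0" "\<And>y. norm (inv_into UNIV T y) \<le> norm y * K'"
    using bounded_linear.pos_bounded[OF T(3)] by blast
  define \<eta> where "\<eta> = 1 / K'"
  have \<eta>: "\<eta> > 0" "\<eta> \<le> norm (T (\<phi> i))" for i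
    using K'(1) K'(2)[of "T (\<phi> i)"] T(2) by (simp_all add: \<eta>_def bij_is_inj norm_one field_simps)
  show ?thesis
  proof (cases "\<forall>j. (\<lambda>i. l1_nth (T (\<phi> i)) j) \<longlonglongrightarrow> 0")
    case True
    have "\<eta> / 2 / K * real n \<le> \<Lambda> n" for n
    proof -
      obtain s where s: "strict_mono s" "real n * (\<eta> / 2) \<le> norm (\<Sum>k<n. T (\<phi> (s k)))"
        using gliding_hump[of "\<lambda>i. T (\<phi> i)" \<eta> n] True \<eta> by blast
      have "(\<Sum>k<n. T (\<phi> (s k))) = T (\<Sum>k<n. \<phi> (s k))"
        using bounded_linear.linear[OF T(1)] by (simp add: linear_sum)
      with s(2) K(2)[of "\<Sum>k<n. \<phi> (s k)"] have "real n * (\<eta> / 2) \<le> norm (\<Sum>k<n. \<phi> (s k)) * K"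
        by simp
      also have "\<dots> \<le> \<Lambda> n * K"
        using K(1) norm_spread_sum_le[OF s(1)] by simp
      finally show ?thesis using K(1) by (simp add: field_simps)
    qed
    from this[of "2 ^ j" for j] have "linear_growth (\<eta> / 2 / K)"
      using K(1) \<eta>(1) by (simp add: linear_growth_def)
    then show ?thesis ..
  next
    case False
    then obtain j r where r: "r > 0" "\<forall>N. \<exists>i\<ge>N. r \<le> \<bar>l1_nth (T (\<phi> i)) j\<bar>"
      unfolding LIMSEQ_iff by (auto simp: not_less)
    let ?f = "\<lambda>x. l1_nth (T x) j"
    have f: "bounded_linear ?f"
      by (rule bounded_linear_compose[OF bounded_linear_l1_nth T(1)])
    then obtain C where C: "C > 0" "\<And>x. norm (?f x) \<le> norm x * C"
      using bounded_linear.pos_bounded[OF f] by blast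
    have "r / C * real n \<le> \<Lambda> n" for n
      using growth_of_nonnull_functional[of ?f C r n] bounded_linear.linear[OF f] C r(2)
      by (simp add: infinite_nat_iff_unbounded_le mult.commute field_simps)
    from this[of "2 ^ j" for j] have "linear_growth (r / C)"
      using C(1) r(1) by (simp add: linear_growth_def)
    then show ?thesis ..
  qed
qed

text \<open>The map sending a sequence to the series with these coefficients is bounded because the \<open>\<phi> i\<close> have
  norm one, bounded below by \<open>norm_ge_sum_abs\<close>, and onto because by the same estimate the coefficients
  of any convergent series are absolutely summable.\<close>

lemma isomorphic_l1_if_linear_growth:
  assumes basis: "schauder_basis \<phi>" and growth: "linear_growth c"
  shows "isomorphic_spaces TYPE('a) TYPE(l1)"
proof -
  have c: "c > 0" using growth by (simp add: linear_growth_def)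
  define S :: "l1 \<Rightarrow> 'a" where "S a = (\<Sum>i. l1_nth a i *\<^sub>R \<phi> i)" for a
  have summable: "summable (\<lambda>i. l1_nth a i *\<^sub>R \<phi> i)" for a
    by (rule summable_norm_cancel) (simp add: norm_one summable_l1_nth)
  have S: "bounded_linear S"
  proof (rule bounded_linear_intro[where K = 1])
    show "S (a + b) = S a + S b" for a b
      by (simp add: S_def plus_l1.rep_eq scaleR_add_left suminf_add[OF summable summable])
    show "S (r *\<^sub>R a) = r *\<^sub>R S a" for r a
      using suminf_scaleR_right[OF summable, of r a] by (simp add: S_def scaleR_l1.rep_eq)
    show "norm (S a) \<le> norm a * 1" for a
      unfolding S_def norm_l1.rep_eq
      by (rule order.trans[OF summable_norm]) (simp_all add: norm_one summable_l1_nth)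
  qed
  have lower: "c * norm a \<le> norm (S a)" for a
  proof (rule LIMSEQ_le)
    show "(\<lambda>n. c * (\<Sum>i<n. \<bar>l1_nth a i\<bar>)) \<longlonglongrightarrow> c * norm a"
      unfolding norm_l1.rep_eq by (intro tendsto_mult_left summable_LIMSEQ summable_l1_nth)
    show "(\<lambda>n. norm (\<Sum>i<n. l1_nth a i *\<^sub>R \<phi> i)) \<longlonglongrightarrow> norm (S a)"
      unfolding S_def by (intro tendsto_norm summable_LIMSEQ summable)
  qed (use norm_ge_sum_abs[OF growth] in blast)
  have "inj S"
  proof (rule injI)
    fix a b assume "S a = S b"
    then have "S (a - b) = 0" by (simp add: linear_diff[OF bounded_linear.linear[OF S]])
    with lower[of "a - b"] c show "a = b" by (simp add: mult_le_0_iff)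
  qed
  have "\<exists>a. S a = x" for x
  proof -
    obtain \<alpha> where \<alpha>: "(\<lambda>i. \<alpha> i *\<^sub>R \<phi> i) sums x"
      using basis unfolding schauder_basis_def by blast
    then have "Bseq (\<lambda>n. \<Sum>i<n. \<alpha> i *\<^sub>R \<phi> i)"
      unfolding sums_def by (intro convergent_imp_Bseq convergentI)
    then obtain B where B: "\<And>n. norm (\<Sum>i<n. \<alpha> i *\<^sub>R \<phi> i) \<le> B"
      unfolding Bseq_def by blast
    have "(\<Sum>i<n. \<bar>\<alpha> i\<bar>) \<le> B / c" for n
      using norm_ge_sum_abs[OF growth, of \<alpha> n] B[of n] c by (simp add: field_simps)
    then have "summable (\<lambda>i. \<bar>\<alpha> i\<bar>)"
      by (intro bounded_imp_summable[of _ "B / c"])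
        (auto simp: lessThan_Suc_atMost[symmetric] simp del: sum.lessThan_Suc)
    then have "S (Abs_l1 \<alpha>) = x"
      using sums_unique[OF \<alpha>] by (simp add: S_def Abs_l1_inverse)
    then show ?thesis ..
  qed
  then have "bij S" using \<open>inj S\<close> by (metis bijI surjI surj_def)
  let ?R = "inv_into UNIV S"
  have inv: "S (?R x) = x" "?R (S a) = a" for x a
    using \<open>bij S\<close> by (simp_all add: bij_is_surj surj_f_inv_f bij_is_inj)
  have "bounded_linear (?R)"
  proof (rule bounded_linear_intro[where K = "1 / c"])
    show "?R (x + y) = ?R x + ?R y" for x y
      by (metis inv linear_add[OF bounded_linear.linear[OF S]])
    show "?R (r *\<^sub>R x) = r *\<^sub>R ?R x" for r x
      by (metis inv linear_cmul[OF bounded_linear.linear[OF S]])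
    show "norm (?R x) \<le> norm x * (1 / c)" for x
      using lower[of "?R x"] c by (simp add: inv field_simps)
  qed
  moreover have "inv_into UNIV ?R = S" using \<open>bij S\<close> by (rule inv_inv_eq)
  ultimately show ?thesis
    unfolding isomorphic_spaces_def using S \<open>bij S\<close> by (metis bij_imp_bij_inv)
qed

section \<open>Growth of the maxima over Hadamard and Sylvester matrices\<close>

lemma rho_matrix_le:
  assumes "n \<ge> 1" and "\<And>m. m \<le> n \<Longrightarrow> norm (\<Sum>i<n. (\<Sum>k<m. H $$ (k, i)) *\<^sub>R \<phi> i) \<le> B"
  shows "rho_matrix \<phi> n H \<le> B"
  unfolding rho_matrix_def using assms by (intro Max.boundedI) auto

lemma rho_matrix_ge:
  assumes "m \<in> {1..n}"
  shows "norm (\<Sum>i<n. (\<Sum>k<m. H $$ (k, i)) *\<^sub>R \<phi> i) \<le> rho_matrix \<phi> n H"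
  unfolding rho_matrix_def using assms by (intro Max_ge) auto

text \<open>The column sums over the first \<open>m\<close> rows have square sum at most \<open>n\<^sup>2\<close>. The level \<open>K\<close> in
  \<open>norm_le_truncation\<close> is chosen so that the first term is half of the assumed lower bound
  \<open>\<delta> * (n * sqrt n)\<close>; the other half has to come from \<open>\<Lambda> n\<close>.\<close>

lemma linear_growth_if_rho_ge:
  assumes "\<delta> > 0" and ge: "\<And>n. n \<in> hadamard_orders \<Longrightarrow> \<delta> \<le> rho \<phi> n / (real n * sqrt (real n))"
  shows "linear_growth (\<delta>\<^sup>2 / 4)"
  unfolding linear_growth_def
proof (intro conjI allI)
  fix j
  define n :: nat where "n = 2 ^ j"
  define s where "s = sqrt (real n)"
  have n: "n \<ge> 1" "hadamard_matrix n (sylvester j)"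
    by (simp_all add: n_def hadamard_sylvester)
  have s: "s > 0" "real n = s\<^sup>2" using n(1) by (simp_all add: s_def)
  define K where "K = 2 / \<delta> * s"
  have K: "K > 0" using s \<open>\<delta> > 0\<close> by (simp add: K_def)
  define B where "B = (real n)\<^sup>2 / K + K * \<Lambda> n"
  have "rho_matrix \<phi> n H \<le> B" if H: "hadamard_matrix n H" for H
  proof (rule rho_matrix_le[OF n(1)])
    fix m assume "m \<le> n"
    have "real m * real n / K \<le> (real n)\<^sup>2 / K"
      using \<open>m \<le> n\<close> K by (intro divide_right_mono) (simp_all add: power2_eq_square mult_right_mono)
    with norm_le_truncation[OF K, where n = n and a = "\<lambda>i. \<Sum>k<m. H $$ (k, i)"]
    show "norm (\<Sum>i<n. (\<Sum>k<m. H $$ (k, i)) *\<^sub>R \<phi> i) \<le> B"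
      unfolding B_def hadamard_partial_sums_square[OF H \<open>m \<le> n\<close>] by linarith
  qed
  then have "rho \<phi> n \<le> B"
    unfolding rho_def using n(2) by (intro Max.boundedI) (auto simp: finite_hadamard_matrices)
  moreover have "\<delta> \<le> rho \<phi> n / (real n * s)"
    unfolding s_def using n by (intro ge) (auto simp: hadamard_orders_def)
  then have "\<delta> * (real n * s) \<le> rho \<phi> n"
    using n(1) s by (simp add: pos_le_divide_eq)
  moreover have "(real n)\<^sup>2 / K = \<delta> * (real n * s) / 2"
    using s \<open>\<delta> > 0\<close> by (simp add: K_def field_simps power2_eq_square)
  ultimately have "\<delta> * (real n * s) / 2 \<le> 2 / \<delta> * s * \<Lambda> n"
    unfolding B_def K_def by linarith
  then have "s * (\<delta>\<^sup>2 / 4 * real n) \<le> s * \<Lambda> n"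
    using \<open>\<delta> > 0\<close> by (simp add: field_simps power2_eq_square)
  then show "\<delta>\<^sup>2 / 4 * 2 ^ j \<le> \<Lambda> (2 ^ j)"
    using s(1) by (simp add: n_def)
qed (use \<open>\<delta> > 0\<close> in simp)

text \<open>The maximum ranges over all Hadamard matrices of order \<open>n\<close>, so the rows of one of them may be
  multiplied by signs. For signs provided by Khintchine's inequality the column sums over all rows
  have average modulus of order \<open>sqrt n\<close>.\<close>

lemma rho_ge_if_linear_growth:
  assumes growth: "linear_growth c" and n: "n \<in> hadamard_orders"
  shows "9 / 16 * c \<le> rho \<phi> n / (real n * sqrt (real n))"
proof -
  obtain H where n1: "n \<ge> 1" and H: "hadamard_matrix n H"
    using n by (auto simp: hadamard_orders_def)
  obtain \<theta> where \<theta>: "\<And>k. \<theta> k \<in> {-1, 1 :: real}"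
    and le: "9 / 16 * real n * sqrt (real n) \<le> (\<Sum>i<n. \<bar>\<Sum>k<n. \<theta> k * H $$ (k, i)\<bar>)"
    using exists_signs_sum_abs_ge[of n n "\<lambda>k i. H $$ (k, i)"] hadamard_entry_square[OF H] by blast
  define H' where "H' = mat n n (\<lambda>(k, i). \<theta> k * H $$ (k, i))"
  have H': "hadamard_matrix n H'"
    unfolding H'_def by (rule hadamard_flip_rows[OF H \<theta>])
  have c: "c > 0" using growth by (simp add: linear_growth_def)
  have "c * (9 / 16 * real n * sqrt (real n)) \<le> c * (\<Sum>i<n. \<bar>\<Sum>k<n. \<theta> k * H $$ (k, i)\<bar>)"
    using le c by simp
  also have "\<dots> = c * (\<Sum>i<n. \<bar>\<Sum>k<n. H' $$ (k, i)\<bar>)"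
    by (simp add: H'_def)
  also have "\<dots> \<le> norm (\<Sum>i<n. (\<Sum>k<n. H' $$ (k, i)) *\<^sub>R \<phi> i)"
    by (rule norm_ge_sum_abs[OF growth])
  also have "\<dots> \<le> rho_matrix \<phi> n H'"
    using n1 by (intro rho_matrix_ge) simp
  also have "\<dots> \<le> rho \<phi> n"
    unfolding rho_def using H' by (intro Max_ge) (auto simp: finite_hadamard_matrices)
  finally show ?thesis using n1 by (simp add: pos_le_divide_eq algebra_simps)
qed

text \<open>There are \<open>2 ^ (n - k)\<close> columns that are multiples of \<open>2 ^ k\<close>, so the pointwise bound on the
  Walsh-Dirichlet kernel becomes one term for each power of two.\<close>

lemma rho_sylvester_le: "rho_sylvester \<phi> n \<le> \<Lambda> (2 ^ n) + (\<Sum>k<n. 2 ^ k * \<Lambda> (2 ^ (n - k)))"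
  unfolding rho_sylvester_def
proof (rule rho_matrix_le)
  fix m :: nat assume m: "m \<le> 2 ^ n"
  let ?b = "\<lambda>i. 1 + (\<Sum>k<n. if 2 ^ k dvd i then 2 ^ k else 0) :: real"
  have level: "norm (\<Sum>i<2 ^ n. (if 2 ^ k dvd i then 2 ^ k else 0 :: real) *\<^sub>R \<phi> i) \<le> 2 ^ k * \<Lambda> (2 ^ (n - k))"
    if "k < n" for k
  proof -
    have split: "(2::nat) ^ n = 2 ^ k * 2 ^ (n - k)"
      using that by (simp add: power_add[symmetric])
    have "(\<Sum>i<2 ^ n. (if 2 ^ k dvd i then 2 ^ k else 0 :: real) *\<^sub>R \<phi> i)
        = (\<Sum>i | i < 2 ^ n \<and> 2 ^ k dvd i. (2::real) ^ k *\<^sub>R \<phi> i)"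
      by (rule sum.mono_neutral_cong_right) auto
    also have "\<dots> = (\<Sum>l<2 ^ (n - k). (2::real) ^ k *\<^sub>R \<phi> (2 ^ k * l))"
      by (rule sum.reindex_bij_witness[of _ "\<lambda>l. 2 ^ k * l" "\<lambda>i. i div 2 ^ k"])
        (auto simp: split less_mult_imp_div_less mult.commute)
    also have "\<dots> = (2::real) ^ k *\<^sub>R (\<Sum>l<2 ^ (n - k). \<phi> (2 ^ k * l))"
      by (simp add: scaleR_sum_right)
    also have "norm \<dots> \<le> 2 ^ k * \<Lambda> (2 ^ (n - k))"
      using norm_spread_sum_le[of "\<lambda>l. 2 ^ k * l" "2 ^ (n - k)"] by (simp add: strict_mono_def)
    finally show ?thesis .
  qed
  have "norm (\<Sum>i<2 ^ n. walsh_dirichlet n m i *\<^sub>R \<phi> i) \<le> norm (\<Sum>i<2 ^ n. ?b i *\<^sub>R \<phi> i)"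
    by (intro norm_mono_abs order.trans[OF abs_walsh_dirichlet_le[OF m]] abs_ge_self) simp
  also have "(\<Sum>i<2 ^ n. ?b i *\<^sub>R \<phi> i)
      = (\<Sum>i<2 ^ n. \<phi> i) + (\<Sum>i<2 ^ n. \<Sum>k<n. (if 2 ^ k dvd i then 2 ^ k else 0 :: real) *\<^sub>R \<phi> i)"
    by (simp only: scaleR_add_left sum.distrib scaleR_sum_left scaleR_one)
  also have "(\<Sum>i<2 ^ n. \<Sum>k<n. (if 2 ^ k dvd i then 2 ^ k else 0 :: real) *\<^sub>R \<phi> i)
      = (\<Sum>k<n. \<Sum>i<2 ^ n. (if 2 ^ k dvd i then 2 ^ k else 0 :: real) *\<^sub>R \<phi> i)"
    by (rule sum.swap)
  also have "norm ((\<Sum>i<2 ^ n. \<phi> i) + \<dots>) \<le> \<Lambda> (2 ^ n) + norm \<dots>"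
    unfolding \<Lambda>_def by (rule norm_triangle_ineq)
  also have "\<dots> \<le> \<Lambda> (2 ^ n) + (\<Sum>k<n. 2 ^ k * \<Lambda> (2 ^ (n - k)))"
    using level by (intro add_left_mono sum_norm_le) simp
  finally show "norm (\<Sum>i<2 ^ n. (\<Sum>k<m. sylvester n $$ (k, i)) *\<^sub>R \<phi> i)
      \<le> \<Lambda> (2 ^ n) + (\<Sum>k<n. 2 ^ k * \<Lambda> (2 ^ (n - k)))"
    by (simp add: walsh_dirichlet_def)
qed simp

text \<open>After division by \<open>2 ^ n\<close> the upper bound for \<open>rho_sylvester\<close> is essentially the sum of the first
  \<open>n\<close> terms of the nonincreasing sequence \<open>\<mu> j = \<Lambda> (2 ^ j) / 2 ^ j\<close>. Their averages are asymptotically at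
  least \<open>\<epsilon>\<close>, hence so is every term: if \<open>\<mu> J\<close> were smaller, so would be all later terms and the limit of
  the averages.\<close>

lemma linear_growth_if_rho_sylvester_ge:
  assumes "\<epsilon> > 0" and ge: "\<And>n. n \<ge> 1 \<Longrightarrow> \<epsilon> \<le> rho_sylvester \<phi> n / (real n * 2 ^ n)"
  shows "linear_growth \<epsilon>"
  unfolding linear_growth_def
proof (intro conjI allI)
  fix J
  define \<mu> where "\<mu> j = \<Lambda> (2 ^ j) / 2 ^ j" for j
  have \<mu>_le_1: "\<mu> j \<le> 1" for j
    using \<Lambda>_le[of "2 ^ j"] by (simp add: \<mu>_def)
  have \<mu>_nonneg: "\<mu> j \<ge> 0" for j
    by (simp add: \<mu>_def \<Lambda>_def)
  have main: "\<epsilon> * real n \<le> 1 + real J + real n * \<mu> J" if "n \<ge> 1" for n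
  proof -
    have "\<epsilon> * real n * 2 ^ n \<le> rho_sylvester \<phi> n"
      using ge[OF that] that by (simp add: pos_le_divide_eq mult.assoc)
    also have "\<dots> \<le> \<Lambda> (2 ^ n) + (\<Sum>k<n. 2 ^ k * \<Lambda> (2 ^ (n - k)))" by (rule rho_sylvester_le)
    also have "\<dots> = 2 ^ n * (\<mu> n + (\<Sum>k<n. \<mu> (n - k)))"
      unfolding distrib_left sum_distrib_left
      by (intro arg_cong2[of _ _ _ _ "(+)"] sum.cong refl) (simp_all add: \<mu>_def power_diff)
    finally have "\<epsilon> * real n \<le> \<mu> n + (\<Sum>k<n. \<mu> (n - k))"
      by (simp add: mult.commute[of _ "2 ^ n"])
    also have "(\<Sum>k<n. \<mu> (n - k)) = (\<Sum>i<n. \<mu> (Suc i))"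
      by (subst sum.nat_diff_reindex[symmetric]) (intro sum.cong refl, simp add: Suc_diff_Suc)
    also have "\<dots> \<le> (\<Sum>i<n. \<mu> J + (if i < J then 1 else 0))"
    proof (rule sum_mono)
      fix i
      have "\<mu> (Suc i) \<le> \<mu> J" if "\<not> i < J"
        unfolding \<mu>_def using that by (intro \<Lambda>_ratio_antimono) simp
      then show "\<mu> (Suc i) \<le> \<mu> J + (if i < J then 1 else 0)"
        using \<mu>_le_1[of "Suc i"] \<mu>_nonneg[of J] by (cases "i < J") simp_all
    qed
    also have "\<dots> = real n * \<mu> J + real (card ({..<n} \<inter> {i. i < J}))"
      by (simp add: sum.distrib sum.If_cases)
    also have "card ({..<n} \<inter> {i. i < J}) \<le> J"
      using card_mono[of "{..<J}" "{..<n} \<inter> {i. i < J}"] by auto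
    finally show ?thesis using \<mu>_le_1[of n] by simp
  qed
  have "\<epsilon> \<le> \<mu> J"
  proof (rule ccontr)
    assume "\<not> \<epsilon> \<le> \<mu> J"
    then obtain n where n: "1 + real J < real n * (\<epsilon> - \<mu> J)"
      using reals_Archimedean3[of "\<epsilon> - \<mu> J"] by auto
    then have "n \<ge> 1" by (cases n) auto
    from main[OF this] n show False by (simp add: algebra_simps)
  qed
  then show "\<epsilon> * 2 ^ J \<le> \<Lambda> (2 ^ J)" by (simp add: \<mu>_def pos_le_divide_eq)
qed (rule \<open>\<epsilon> > 0\<close>)

lemma rho_sylvester_ge_if_linear_growth:
  assumes growth: "linear_growth c" and "n \<ge> 1"
  shows "c / 4 \<le> rho_sylvester \<phi> n / (real n * 2 ^ n)"
proof -
  obtain m where m: "m \<in> {1..2 ^ n}" and le: "real n * 2 ^ n \<le> 4 * walsh_lebesgue n m"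
    using exists_large_walsh_lebesgue by blast
  have c: "c > 0" using growth by (simp add: linear_growth_def)
  have "c * (real n * 2 ^ n) \<le> c * (4 * walsh_lebesgue n m)"
    using le c by simp
  also have "\<dots> = 4 * (c * (\<Sum>i<2 ^ n. \<bar>\<Sum>k<m. sylvester n $$ (k, i)\<bar>))"
    by (simp add: walsh_lebesgue_def walsh_dirichlet_def)
  also have "\<dots> \<le> 4 * norm (\<Sum>i<2 ^ n. (\<Sum>k<m. sylvester n $$ (k, i)) *\<^sub>R \<phi> i)"
    by (intro mult_left_mono norm_ge_sum_abs[OF growth]) simp
  also have "\<dots> \<le> 4 * rho_sylvester \<phi> n"
    unfolding rho_sylvester_def by (intro mult_left_mono rho_matrix_ge m) simp
  finally show ?thesis using \<open>n \<ge> 1\<close> by (simp add: pos_le_divide_eq)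
qed

end

theorem theorem4p10:
  fixes \<phi> :: "nat \<Rightarrow> 'a::banach"
  assumes "normalized \<phi>"
    and "subsymmetric_basis \<phi>"
    and "is_subsymmetric_constant \<phi> 1"
  shows "((\<exists>\<delta>>0. \<forall>n\<in>hadamard_orders. rho \<phi> n / (real n * sqrt (real n)) \<ge> \<delta>)
            \<longleftrightarrow> isomorphic_spaces TYPE('a) TYPE(l1))
       \<and> (isomorphic_spaces TYPE('a) TYPE(l1)
            \<longleftrightarrow> (\<exists>\<epsilon>>0. \<forall>n\<ge>1. rho_sylvester \<phi> n / (real n * 2 ^ n) \<ge> \<epsilon>))"
proof -
  interpret one_subsymmetric_sequence \<phi>
    using assms(1,3) by unfold_locales (simp_all add: normalized_def is_subsymmetric_constant_def)
  have "schauder_basis (\<lambda>i. \<phi> (id i))"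
    using assms(2) bij_id unfolding subsymmetric_basis_def unconditional_basis_def by blast
  then have basis: "schauder_basis \<phi>" by simp
  have iso: "isomorphic_spaces TYPE('a) TYPE(l1) \<longleftrightarrow> (\<exists>c. linear_growth c)"
    using linear_growth_if_isomorphic_l1 isomorphic_l1_if_linear_growth[OF basis] by blast
  have pos: "c > 0" if "linear_growth c" for c
    using that by (simp add: linear_growth_def)
  have "(\<exists>\<delta>>0. \<forall>n\<in>hadamard_orders. rho \<phi> n / (real n * sqrt (real n)) \<ge> \<delta>)
      \<longleftrightarrow> (\<exists>c. linear_growth c)" (is "?i \<longleftrightarrow> _")
  proof
    show "\<exists>c. linear_growth c" if ?i using that linear_growth_if_rho_ge by blast
    assume "\<exists>c. linear_growth c"
    then obtain c where c: "linear_growth c" ..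
    show ?i
      using rho_ge_if_linear_growth[OF c] pos[OF c] by (intro exI[of _ "9 / 16 * c"]) simp
  qed
  moreover have "(\<exists>\<epsilon>>0. \<forall>n\<ge>1. rho_sylvester \<phi> n / (real n * 2 ^ n) \<ge> \<epsilon>)
      \<longleftrightarrow> (\<exists>c. linear_growth c)" (is "?iii \<longleftrightarrow> _")
  proof
    show "\<exists>c. linear_growth c" if ?iii using that linear_growth_if_rho_sylvester_ge by blast
    assume "\<exists>c. linear_growth c"
    then obtain c where c: "linear_growth c" ..
    show ?iii
      using rho_sylvester_ge_if_linear_growth[OF c] pos[OF c] by (intro exI[of _ "c / 4"]) simp
  qed
  ultimately show ?thesis using iso by blast
qed

end
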